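(* Let $\mathscr{R}$ be a ratio-covariety and $S\in\mathscr{R}$ with $S\neq\mathbb{N}$. Then the set of children of $S$ in the tree $\mathrm{G}(\mathscr{R})$ is $$\{S\cup\{x\}\mid x\in\mathrm{SG}(S),\ \mathrm{m}(S)<x<\mathrm{r}(S)\ \text{and}\ S\cup\{x\}\in\mathscr{R}\}.$$
   Context: $\mathbb{N}$ is the set of nonnegative integers. A numerical semigroup is a submonoid $S$ of $(\mathbb{N},+)$ with $\mathbb{N}\setminus S$ finite. Its multiplicity is $\mathrm{m}(S)=\min(S\setminus\{0\})$. If $S\neq\mathbb{N}$, the ratio of $S$ is $\mathrm{r}(S)=\min\{s\in S\mid \mathrm{m}(S)\nmid s\}$ (equivalently, the smallest minimal generator of $S$ different from $\mathrm{m}(S)$). A ratio-covariety is a nonempty family $\mathscr{R}$ of numerical semigroups such that: 1) $\mathscr{R}$ has a minimum with respect to inclusion, denoted $\min(\mathscr{R})$; 2) if $S,T\in\mathscr{R}$ then $S\cap T\in\mathscr{R}$; 3) if $S\in\mathscr{R}$ and $S\neq\min(\mathscr{R})$, then $S\setminus\{\mathrm{r}(S)\}\in\mathscr{R}$ (in particular $\mathrm{r}(S)$ is defined, i.e. $S\neq\mathbb{N}$). $\mathrm{G}(\mathscr{R})$ is the graph with vertex set $\mathscr{R}$ in which $(S,T)\in\mathscr{R}\times\mathscr{R}$ is an edge if and only if $T=S\setminus\{\mathrm{r}(S)\}$; it is a tree with root $\min(\mathscr{R})$. If $(u,v)$ is an edge, $u$ is called a child of $v$. For a numerical semigroup $S$,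 the set of pseudo-Frobenius numbers is $\mathrm{PF}(S)=\{z\in\mathbb{Z}\setminus S\mid z+s\in S\text{ for all }s\in S\setminus\{0\}\}$, and the set of special gaps is $\mathrm{SG}(S)=\{x\in\mathrm{PF}(S)\mid 2x\in S\}$. *)

theory Defs
  imports "Graph_Theory.Pair_Digraph"
begin

definition numerical_semigroup :: "nat set \<Rightarrow> bool" where
  "numerical_semigroup S \<longleftrightarrow>
     0 \<in> S \<and> (\<forall>a\<in>S. \<forall>b\<in>S. a + b \<in> S) \<and> finite (UNIV - S)"

definition ns_multiplicity :: "nat set \<Rightarrow> nat" where
  "ns_multiplicity S = (LEAST s. s \<in> S - {0})"

text \<open>For \<open>S = UNIV\<close> no element qualifies and the value below is arbitrary; the
  definitions using the ratio therefore carry an explicit \<open>S \<noteq> UNIV\<close>.\<close>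

definition ns_ratio :: "nat set \<Rightarrow> nat" where
  "ns_ratio S = (LEAST s. s \<in> S \<and> \<not> ns_multiplicity S dvd s)"

text \<open>Pseudo-Frobenius numbers are integers: \<open>-1\<close> is one for \<open>S = UNIV\<close>.\<close>

definition pseudo_frobenius :: "nat set \<Rightarrow> int set" where
  "pseudo_frobenius S = {z. z \<notin> int ` S \<and> (\<forall>s\<in>S - {0}. z + int s \<in> int ` S)}"

definition special_gaps :: "nat set \<Rightarrow> int set" where
  "special_gaps S = {x \<in> pseudo_frobenius S. 2 * x \<in> int ` S}"

text \<open>The order on \<open>nat set\<close> is inclusion, so \<open>LEAST\<close> denotes the minimum with respect to
  inclusion, provided it exists.\<close>

definition family_min :: "nat set set \<Rightarrow> nat set" where
  "family_min R = (LEAST M. M \<in> R)"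

definition ratio_covariety :: "nat set set \<Rightarrow> bool" where
  "ratio_covariety R \<longleftrightarrow>
     R \<noteq> {} \<and>
     (\<forall>S\<in>R. numerical_semigroup S) \<and>
     (\<exists>M\<in>R. \<forall>S\<in>R. M \<subseteq> S) \<and>
     (\<forall>S\<in>R. \<forall>T\<in>R. S \<inter> T \<in> R) \<and>
     (\<forall>S\<in>R. S \<noteq> family_min R \<longrightarrow> S \<noteq> UNIV \<and> S - {ns_ratio S} \<in> R)"

definition covariety_graph :: "nat set set \<Rightarrow> nat set pair_pre_digraph" where
  "covariety_graph R =
     \<lparr>pverts = R,
      parcs = {(S, T). S \<in> R \<and> T \<in> R \<and> S \<noteq> UNIV \<and> T = S - {ns_ratio S}}\<rparr>"

text \<open>Arcs point towards the root, so the children of \<open>v\<close> are its in-neighbours.\<close>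

definition children :: "'a pair_pre_digraph \<Rightarrow> 'a \<Rightarrow> 'a set" where
  "children G v = {u. (u, v) \<in> parcs G}"

end

theory Submission
  imports Defs
begin

text \<open>Removing the ratio of a numerical semigroup \<open>T\<close>, or adding to \<open>S\<close> an element \<open>x\<close> with
  \<open>m(S) < x < r(S)\<close>, happens above the multiplicity and hence preserves it. With a common
  multiplicity \<open>m\<close>, the ratio is the first element that is not a multiple of \<open>m\<close>. If \<open>x = r(T)\<close>
  and \<open>S = T - {x}\<close>, all elements of \<open>S\<close> that are not multiples of \<open>m\<close> lie beyond \<open>x\<close>, so
  \<open>x < r(S)\<close>; and \<open>x\<close> is a special gap of \<open>S\<close> because \<open>2x\<close> and \<open>x + s\<close>,
  for nonzero \<open>s\<close> in \<open>S\<close>, lie in \<open>T\<close> and differ from \<open>x\<close>. Conversely, a gap \<open>x\<close> of \<open>S\<close> is not a multiple of \<open>m\<close>, and below \<open>r(S)\<close> the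
  semigroup \<open>S\<close> contains only multiples of \<open>m\<close>; so \<open>x\<close> is the ratio of \<open>S \<union> {x}\<close>, and
  removing it gives \<open>S\<close> back.\<close>

lemma cofinite_nat_contains_all_large:
  fixes S :: "nat set"
  assumes "finite (UNIV - S)"
  obtains k where "\<And>n. n \<ge> k \<Longrightarrow> n \<in> S"
  using assms by (metis DiffI UNIV_I finite_nat_set_iff_bounded not_le)

lemma multiplicity_properties:
  assumes "numerical_semigroup S"
  shows ns_multiplicity_in: "ns_multiplicity S \<in> S"
    and ns_multiplicity_pos: "0 < ns_multiplicity S"
    and ns_multiplicity_le: "\<And>s. s \<in> S \<Longrightarrow> 0 < s \<Longrightarrow> ns_multiplicity S \<le> s"
proof -
  obtain k where k: "\<And>n. n \<ge> k \<Longrightarrow> n \<in> S"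
    using assms cofinite_nat_contains_all_large unfolding numerical_semigroup_def by blast
  have "Suc k \<in> S - {0}"
    using k by simp
  then have "ns_multiplicity S \<in> S - {0}"
    unfolding ns_multiplicity_def by (rule LeastI)
  then show "ns_multiplicity S \<in> S" "0 < ns_multiplicity S"
    by auto
  show "ns_multiplicity S \<le> s" if "s \<in> S" "0 < s" for s
    unfolding ns_multiplicity_def using that by (intro Least_le) simp
qed

lemma numerical_semigroup_multiple_in:
  assumes "numerical_semigroup S" "a \<in> S" "a dvd n"
  shows "n \<in> S"
proof -
  have "a * k \<in> S" for k
    using assms by (induction k) (auto simp: numerical_semigroup_def)
  then show ?thesis
    using assms(3) by auto
qed

lemma ns_multiplicity_ne_1:
  assumes "numerical_semigroup S" "S \<noteq> UNIV"
  shows "ns_multiplicity S \<noteq> 1"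
proof
  assume "ns_multiplicity S = 1"
  then have "n \<in> S" for n
    using numerical_semigroup_multiple_in ns_multiplicity_in assms(1) by (metis one_dvd)
  then show False
    using assms(2) by blast
qed

text \<open>The ratio exists because \<open>S\<close> is cofinite and so contains numbers \<open>m k + 1\<close>, which are
  not multiples of \<open>m\<close> since \<open>S \<noteq> UNIV\<close> forces \<open>m > 1\<close>.\<close>

lemma ratio_properties:
  assumes "numerical_semigroup S" "S \<noteq> UNIV"
  shows ns_ratio_in: "ns_ratio S \<in> S"
    and ns_ratio_not_multiple: "\<not> ns_multiplicity S dvd ns_ratio S"
proof -
  let ?m = "ns_multiplicity S"
  obtain k where k: "\<And>n. n \<ge> k \<Longrightarrow> n \<in> S"
    using assms(1) cofinite_nat_contains_all_large unfolding numerical_semigroup_def by blast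
  have "k \<le> ?m * k + 1"
    using ns_multiplicity_pos[OF assms(1)] by (simp add: le_SucI)
  then have "?m * k + 1 \<in> S"
    by (rule k)
  moreover have "\<not> ?m dvd ?m * k + 1"
    using ns_multiplicity_ne_1[OF assms] by (metis dvd_add_right_iff dvd_triv_left nat_dvd_1_iff_1)
  ultimately have "?m * k + 1 \<in> S \<and> \<not> ?m dvd ?m * k + 1"
    by (rule conjI)
  then have "ns_ratio S \<in> S \<and> \<not> ?m dvd ns_ratio S"
    unfolding ns_ratio_def by (rule LeastI)
  then show "ns_ratio S \<in> S" "\<not> ?m dvd ns_ratio S"
    by auto
qed

lemma ns_ratio_le:
  assumes "s \<in> S" "\<not> ns_multiplicity S dvd s"
  shows "ns_ratio S \<le> s"
  unfolding ns_ratio_def using assms by (intro Least_le) simp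

lemma ns_multiplicity_less_ns_ratio:
  assumes "numerical_semigroup S" "S \<noteq> UNIV"
  shows "ns_multiplicity S < ns_ratio S"
proof -
  have "ns_ratio S \<noteq> 0" "ns_ratio S \<noteq> ns_multiplicity S"
    using ns_ratio_not_multiple[OF assms] by (metis dvd_0_right, metis dvd_refl)
  then show ?thesis
    using ns_multiplicity_le[OF assms(1) ns_ratio_in[OF assms]] by simp
qed

lemma ns_multiplicity_insert:
  assumes "numerical_semigroup S" "ns_multiplicity S < x"
  shows "ns_multiplicity (insert x S) = ns_multiplicity S"
  unfolding ns_multiplicity_def[of "insert x S"]
proof (rule Least_equality)
  show "ns_multiplicity S \<in> insert x S - {0}"
    using ns_multiplicity_in[OF assms(1)] ns_multiplicity_pos[OF assms(1)] by simp
  show "ns_multiplicity S \<le> y" if "y \<in> insert x S - {0}" for y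
    using that assms(2) ns_multiplicity_le[OF assms(1), of y] by auto
qed

lemma ns_multiplicity_remove:
  assumes "numerical_semigroup T" "ns_multiplicity T < x"
  shows "ns_multiplicity (T - {x}) = ns_multiplicity T"
  unfolding ns_multiplicity_def[of "T - {x}"]
proof (rule Least_equality)
  show "ns_multiplicity T \<in> T - {x} - {0}"
    using ns_multiplicity_in[OF assms(1)] ns_multiplicity_pos[OF assms(1)] assms(2) by simp
  show "ns_multiplicity T \<le> y" if "y \<in> T - {x} - {0}" for y
    using that ns_multiplicity_le[OF assms(1), of y] by auto
qed

text \<open>Adding a nonzero element of \<open>T\<close> to \<open>x\<close> gives an element of \<open>T\<close> larger than \<open>x\<close>, which
  survives the removal of \<open>x\<close>; taking \<open>x\<close> itself as the summand covers \<open>2x\<close>.\<close>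

lemma removed_element_special_gap:
  assumes "numerical_semigroup T" "x \<in> T" "0 < x"
  shows "int x \<in> special_gaps (T - {x})"
proof -
  have add: "x + s \<in> T - {x}" if "s \<in> T" "0 < s" for s
    using assms that by (auto simp: numerical_semigroup_def)
  have "int x + int s \<in> int ` (T - {x})" if "s \<in> T - {x} - {0}" for s
    using add[of s] that by (metis DiffE imageI neq0_conv of_nat_add singletonI)
  moreover have "2 * int x \<in> int ` (T - {x})"
    using add[of x] assms(2,3) by (metis imageI mult_2 of_nat_add)
  ultimately show ?thesis
    by (auto simp: special_gaps_def pseudo_frobenius_def)
qed

lemma ns_ratio_remove_ratio_gt:
  assumes "numerical_semigroup T" "T \<noteq> UNIV"
    and "numerical_semigroup (T - {ns_ratio T})"
  shows "ns_ratio T < ns_ratio (T - {ns_ratio T})"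
proof -
  let ?S = "T - {ns_ratio T}"
  have m: "ns_multiplicity ?S = ns_multiplicity T"
    using ns_multiplicity_remove ns_multiplicity_less_ns_ratio assms(1,2) by blast
  have "?S \<noteq> UNIV"
    by blast
  then have "ns_ratio ?S \<in> ?S" "\<not> ns_multiplicity T dvd ns_ratio ?S"
    using ns_ratio_in[OF assms(3)] ns_ratio_not_multiple[OF assms(3)] m by auto
  then show ?thesis
    using ns_ratio_le[of "ns_ratio ?S" T] by auto
qed

text \<open>\<open>S\<close> contains every multiple of its multiplicity, so a gap is never such a multiple; this
  makes \<open>x\<close> a candidate for the ratio of the enlarged set.\<close>

lemma ns_ratio_insert_gap:
  assumes "numerical_semigroup S" "x \<notin> S" "ns_multiplicity S < x" "x < ns_ratio S"
  shows "ns_ratio (insert x S) = x"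
  unfolding ns_ratio_def[of "insert x S"] ns_multiplicity_insert[OF assms(1,3)]
proof (rule Least_equality)
  show "x \<in> insert x S \<and> \<not> ns_multiplicity S dvd x"
    using numerical_semigroup_multiple_in ns_multiplicity_in assms(1,2) by blast
  show "x \<le> y" if "y \<in> insert x S \<and> \<not> ns_multiplicity S dvd y" for y
    using that ns_ratio_le[of y S] assms(4) by auto
qed

theorem proposition2p7:
  fixes R :: "nat set set" and S :: "nat set"
  assumes "ratio_covariety R"
    and "S \<in> R"
    and "S \<noteq> UNIV"
  shows "children (covariety_graph R) S =
    {S \<union> {x} | x :: nat. int x \<in> special_gaps S \<and>
        ns_multiplicity S < x \<and> x < ns_ratio S \<and> S \<union> {x} \<in> R}"
    (is "_ = ?C")
proof
  have semigroup: "numerical_semigroup T" if "T \<in> R" for T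
    using assms(1) that by (simp add: ratio_covariety_def)
  note S = semigroup[OF assms(2)]
  show "children (covariety_graph R) S \<subseteq> ?C"
  proof
    fix T assume "T \<in> children (covariety_graph R) S"
    then have T: "T \<in> R" "T \<noteq> UNIV" and S_eq: "S = T - {ns_ratio T}"
      by (auto simp: children_def covariety_graph_def)
    note sT = semigroup[OF T(1)]
    note lt = ns_multiplicity_less_ns_ratio[OF sT T(2)]
    have "T = S \<union> {ns_ratio T}"
      using S_eq ns_ratio_in[OF sT T(2)] by auto
    moreover have "int (ns_ratio T) \<in> special_gaps S"
      using removed_element_special_gap[OF sT ns_ratio_in[OF sT T(2)]] lt S_eq by simp
    moreover have "ns_multiplicity S < ns_ratio T"
      using ns_multiplicity_remove[OF sT lt] lt S_eq by simp
    moreover have "ns_ratio T < ns_ratio S"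
      using ns_ratio_remove_ratio_gt[OF sT T(2)] S S_eq by simp
    ultimately show "T \<in> ?C"
      using T(1) by (intro CollectI exI[of _ "ns_ratio T"]) simp
  qed
  show "?C \<subseteq> children (covariety_graph R) S"
  proof
    fix T assume "T \<in> ?C"
    then obtain x where x: "int x \<in> special_gaps S" "ns_multiplicity S < x" "x < ns_ratio S"
      and T: "T = insert x S" "T \<in> R"
      by (simp only: mem_Collect_eq Un_insert_right Un_empty_right) blast
    have "x \<notin> S"
      using x(1) by (auto simp: special_gaps_def pseudo_frobenius_def)
    then have "S = T - {ns_ratio T}"
      using ns_ratio_insert_gap[OF S _ x(2,3)] T(1) by auto
    moreover have "T \<noteq> UNIV"
    proof
      \<comment> \<open>The multiplicity of the full semigroup is 1, and \<open>S\<close> would share it.\<close>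
      assume "T = UNIV"
      then have "ns_multiplicity T \<le> 1"
        using ns_multiplicity_le[OF semigroup[OF T(2)], of 1] by simp
      then have "ns_multiplicity S = 1"
        using ns_multiplicity_insert[OF S x(2)] ns_multiplicity_pos[OF S] T(1) by simp
      then show False
        using ns_multiplicity_ne_1[OF S assms(3)] by simp
    qed
    ultimately show "T \<in> children (covariety_graph R) S"
      using T(2) assms(2) by (simp add: children_def covariety_graph_def)
  qed
qed

end
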